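(* Let $0<q<1$ and $\alpha>-1$. For every $n\in\mathbb{N}_0$ and every $z\in\mathbb{C}$, the generalized $q$-Bernoulli polynomial $B^{(1)}_{n,\alpha}(z;q)$ satisfies $$B^{(1)}_{n,\alpha}(z;q)=(-1)^n\det A_n,$$ where $A_n=(a_{ij})_{i,j=0}^{n}$ is the $(n+1)\times(n+1)$ matrix whose entries are, for $j\in\{0,1,\dots,n\}$, $$a_{0j}=z^j,\qquad a_{ij}=\begin{bmatrix} j\\ i-1\end{bmatrix}_q\frac{1}{2^{j-i+1}}\,\frac{(q^{2\alpha+1};q^2)_{j-i+1}}{(q^{2\alpha+1};q)_{j-i+1}}\quad(1\le i\le n),$$ with the convention that $\begin{bmatrix} j\\ i-1\end{bmatrix}_q=0$, and hence $a_{ij}=0$, when $i-1>j$.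
   Context: Notation: $(a;q)_n=\prod_{k=0}^{n-1}(1-aq^k)$ and $(a;q)_0=1$; $[n]_q=\frac{1-q^n}{1-q}$; $[n]_q!=\prod_{k=1}^n[k]_q$; $\begin{bmatrix} n\\ k\end{bmatrix}_q=\frac{(q;q)_n}{(q;q)_k(q;q)_{n-k}}$ for $0\le k\le n$, and $\begin{bmatrix} n\\ k\end{bmatrix}_q=0$ for $k>n\ge 0$. $\mathbb{N}_0=\{0,1,2,\dots\}$. The $q$-exponential is $e_q(z)=\sum_{n\ge0}\frac{z^n}{[n]_q!}$ for $|z|<\frac1{1-q}$. The function $g^{(1)}_\alpha$ (a normalized first Jackson $q$-Bessel function with base $q^2$) is $$g^{(1)}_\alpha(t;q)=\sum_{n=0}^\infty\frac{(-1)^n\,(t(1-q)/2)^{2n}}{(q^2;q^2)_n(q^{2\alpha+2};q^2)_n}\qquad\left(|t|<\tfrac{2}{1-q}\right).$$ The polynomials $B^{(1)}_{n,\alpha}(z;q)$ are defined by the generating function (for $|t|$ sufficiently small) $$\frac{e_q(zt)\,e_q(-t/2)}{g^{(1)}_\alpha(it;q)}=\sum_{n=0}^\infty B^{(1)}_{n,\alpha}(z;q)\frac{t^n}{[n]_q!}.$$ For $\alpha=-\frac12$ the quotient $\frac{(q^{2\alpha+1};q^2)_m}{(q^{2\alpha+1};q)_m}$ with $m\ge1$ is understood after cancelling the common factor $1-q^{2\alpha+1}$, i.e. as $\frac{(q^{2\alpha+3};q^2)_{m-1}}{(q^{2\alpha+2};q)_{m-1}}$. *)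

theory Defs
  imports Complex_Main "Jordan_Normal_Form.Determinant"
begin

definition qpoch :: "real \<Rightarrow> real \<Rightarrow> nat \<Rightarrow> real" where
  "qpoch a q n = (\<Prod>k<n. 1 - a * q ^ k)"

definition qnum :: "real \<Rightarrow> nat \<Rightarrow> real" where
  "qnum q n = (1 - q ^ n) / (1 - q)"

definition qfact :: "real \<Rightarrow> nat \<Rightarrow> real" where
  "qfact q n = (\<Prod>k=1..n. qnum q k)"

definition qbinom :: "real \<Rightarrow> nat \<Rightarrow> nat \<Rightarrow> real" where
  "qbinom q n k =
     (if k \<le> n then qpoch q q n / (qpoch q q k * qpoch q q (n - k)) else 0)"

text \<open>The two series below carry their intended value only inside their discs of
  convergence, \<open>norm z < 1 / (1 - q)\<close> and \<open>norm t < 2 / (1 - q)\<close> respectively.\<close>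

definition qexp :: "real \<Rightarrow> complex \<Rightarrow> complex" where
  "qexp q z = (\<Sum>n. z ^ n / of_real (qfact q n))"

definition jackson_g1 :: "real \<Rightarrow> real \<Rightarrow> complex \<Rightarrow> complex" where
  "jackson_g1 q \<alpha> t =
     (\<Sum>n. (-1) ^ n * (t * of_real (1 - q) / 2) ^ (2 * n) /
           of_real (qpoch (q\<^sup>2) (q\<^sup>2) n * qpoch (q powr (2 * \<alpha> + 2)) (q\<^sup>2) n))"

text \<open>For fixed \<open>z\<close>, the sequence \<open>n \<mapsto> B\<^sub>n(z)\<close> is the unique one whose \<open>q\<close>-exponential
  generating function converges to the given quotient for all sufficiently small complex
  \<open>t\<close>; how small \<open>t\<close> has to be may depend on \<open>z\<close>. Existence and uniqueness hold for
  \<open>0 < q < 1\<close> and \<open>\<alpha> > -1\<close>, since the quotient is then analytic at \<open>0\<close>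
  and \<open>qfact q m > 0\<close>.\<close>

definition qBernoulli1 :: "real \<Rightarrow> real \<Rightarrow> nat \<Rightarrow> complex \<Rightarrow> complex" where
  "qBernoulli1 q \<alpha> n z =
     (THE b :: nat \<Rightarrow> complex. \<forall>\<^sub>F t in nhds 0.
        (\<lambda>m. b m * (t ^ m / of_real (qfact q m))) sums
          (qexp q (z * t) * qexp q (- t / 2) / jackson_g1 q \<alpha> (\<i> * t))) n"

text \<open>The quotient of \<open>q\<close>-shifted factorials with argument \<open>q powr (2 * \<alpha> + 1)\<close>. At
  \<open>\<alpha> = -1/2\<close> numerator and denominator both contain the vanishing factor
  \<open>1 - q powr (2 * \<alpha> + 1)\<close>, which is cancelled there.\<close>

definition qpoch_quot :: "real \<Rightarrow> real \<Rightarrow> nat \<Rightarrow> real" where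
  "qpoch_quot q \<alpha> m =
     (if \<alpha> = - 1 / 2 \<and> m \<ge> 1
      then qpoch (q powr (2 * \<alpha> + 3)) (q\<^sup>2) (m - 1) / qpoch (q powr (2 * \<alpha> + 2)) q (m - 1)
      else qpoch (q powr (2 * \<alpha> + 1)) (q\<^sup>2) m / qpoch (q powr (2 * \<alpha> + 1)) q m)"

text \<open>Below the subdiagonal, i.e. for \<open>i - 1 > j\<close>, the factor \<open>qbinom q j (i - 1)\<close> is \<open>0\<close>,
  so truncation of \<open>j + 1 - i\<close> plays no role.\<close>

definition qBernoulli1_mat :: "real \<Rightarrow> real \<Rightarrow> nat \<Rightarrow> complex \<Rightarrow> complex mat" where
  "qBernoulli1_mat q \<alpha> n z = mat (n + 1) (n + 1) (\<lambda>(i, j).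
     if i = 0 then z ^ j
     else of_real (qbinom q j (i - 1) * (1 / 2 ^ (j + 1 - i)) * qpoch_quot q \<alpha> (j + 1 - i)))"

end

(* Write x = (1 - q) t / 2. Then e_q(-t/2) = sum (-x)^k / (q;q)_k has the reciprocal
   E(x) = sum q^(k choose 2) x^k / (q;q)_k, and the q-Chu-Vandermonde sum shows that
   E(x) times the even series of g(it) is the series D whose coefficients form the matrix.
   Hence the generating function equals e_q(zt) / D(t); comparing coefficients in
   B(t) D(t) = e_q(zt) gives a unitriangular linear system for the B_n, and subtracting
   B_0, ..., B_(n-1) times the rows below from the top row of A_n leaves (0, ..., 0, B_n). *)

theory Submission
  imports "HOL-Complex_Analysis.Laurent_Convergence" Defs
begin

(* HOL-Analysis has its own mat and det; Defs is imported last so that the names mean those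
   of Jordan_Normal_Form. *)

lemma qpoch_0 [simp]: "qpoch a q 0 = 1"
  by (simp add: qpoch_def)

lemma qpoch_Suc: "qpoch a q (Suc n) = qpoch a q n * (1 - a * q ^ n)"
  by (simp add: qpoch_def)

lemma qpoch_Suc_shift: "qpoch a q (Suc n) = (1 - a) * qpoch (a * q) q n"
  by (simp add: qpoch_def prod.lessThan_Suc_shift mult.assoc del: prod.lessThan_Suc)

lemma qpoch_nonzero:
  assumes "\<And>k. a * q ^ k \<noteq> 1"
  shows "qpoch a q n \<noteq> 0"
  using assms by (auto simp: qpoch_def eq_commute[of 1])

lemma qpoch_self_pos:
  assumes "0 < q" "q < 1"
  shows "qpoch q q n > 0"
  unfolding qpoch_def using assms
  by (intro prod_pos) (simp add: power_Suc[symmetric] power_less_one_iff del: power_Suc)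

lemma qfact_eq_qpoch:
  assumes "q \<noteq> 1"
  shows "qfact q n = qpoch q q n / (1 - q) ^ n"
  using assms
  by (induction n) (simp_all add: qfact_def qnum_def qpoch_Suc prod.nat_ivl_Suc')

section \<open>A Wilf--Zeilberger pair for the coefficient sums\<close>

text \<open>The mate certifies, by the Wilf--Zeilberger method, a first-order recurrence in \<open>m\<close>
  for the sum over \<open>n\<close> of the summands; with \<open>y = q ^ (2 * n)\<close> its multiplier is the
  solution \<open>c / y * (1 - y) * (1 - a * y / q)\<close> of the Gosper equation.\<close>

definition wz_summand :: "real \<Rightarrow> real \<Rightarrow> nat \<Rightarrow> nat \<Rightarrow> real" where
  "wz_summand q a m n =
     (if 2 * n \<le> m
      then q ^ ((m - 2 * n) choose 2) /
             (qpoch q q (m - 2 * n) * (qpoch (q\<^sup>2) (q\<^sup>2) n * qpoch (a * q) (q\<^sup>2) n))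
      else 0)"

definition wz_mate :: "real \<Rightarrow> real \<Rightarrow> nat \<Rightarrow> nat \<Rightarrow> real" where
  "wz_mate q a m n =
     - (q * q ^ m / q ^ (2 * n) * (1 - q ^ (2 * n)) * (1 - a * q ^ (2 * n) / q) * wz_summand q a (Suc m) n)"

text \<open>Once common factors are removed, this is a rational identity in \<open>a\<close>,
  \<open>q\<close> and powers of \<open>q\<close>. The hypothesis on \<open>a\<close> excludes zeros
  of (aq; q^2)_n but admits a = 1, the value belonging to \<alpha> = -1/2.\<close>

lemma wz_equation:
  assumes q: "0 < q" "q < 1" and a: "\<And>k. a * q ^ Suc k \<noteq> 1"
  shows "(1 - a * q ^ m) * (1 - q ^ Suc m) * wz_summand q a (Suc m) n
           - (1 - a * q ^ (2 * m)) * wz_summand q a m n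
         = wz_mate q a m (Suc n) - wz_mate q a m n"
proof -
  define X where "X = qpoch (q\<^sup>2) (q\<^sup>2) n * qpoch (a * q) (q\<^sup>2) n"
  define y where "y = q ^ (2 * n)"
  have q1: "q ^ Suc k < 1" for k using q by (simp add: power_less_one_iff del: power_Suc)
  have y0: "y > 0" using q by (simp add: y_def)
  have nz: "1 - q\<^sup>2 * y \<noteq> 0" using q1[of "2*n+1"] by (simp add: y_def power2_eq_square algebra_simps)
  have nz2: "1 - a * q * y \<noteq> 0" using a[of "2*n"] by (simp add: y_def algebra_simps)
  have X0: "X \<noteq> 0"
    unfolding X_def mult_eq_0_iff de_Morgan_disj
  proof
    show "qpoch (q\<^sup>2) (q\<^sup>2) n \<noteq> 0"
      using qpoch_self_pos[of "q\<^sup>2" n] q by (simp add: power_less_one_iff)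
    show "qpoch (a * q) (q\<^sup>2) n \<noteq> 0"
      using a by (intro qpoch_nonzero) (simp add: power_mult[symmetric] mult.assoc)
  qed
  have XS: "qpoch (q\<^sup>2) (q\<^sup>2) (Suc n) * qpoch (a * q) (q\<^sup>2) (Suc n) = X * ((1 - q\<^sup>2 * y) * (1 - a * q * y))"
    by (simp add: X_def y_def qpoch_Suc power_mult)
  \<comment> \<open>The cases follow the truncation in \<open>wz_summand\<close>: no term survives
    in \<open>lt\<close>; in \<open>eq1\<close> only the first summand and the mate at n do, and y =
    q^(m+1) makes them match; in \<open>eq\<close> just the mate at n + 1 vanishes; in
    \<open>gt\<close> all four terms are present.\<close>
  consider (lt) "m + 1 < 2 * n" | (eq1) "m + 1 = 2 * n" | (eq) "m = 2 * n" | (gt) "2 * n < m" by linarith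
  then show ?thesis
  proof cases
    case lt
    then show ?thesis by (simp add: wz_summand_def wz_mate_def)
  next
    case eq1
    then have "y = q * q ^ m" by (metis y_def Suc_eq_plus1 power_Suc)
    moreover have "Suc m - 2 * n = 0" "\<not> 2 * n \<le> m" "2 * n = Suc m" using eq1 by auto
    ultimately show ?thesis
      using X0 q by (simp add: wz_summand_def wz_mate_def X_def[symmetric] field_simps)
  next
    case eq
    then have m: "q ^ m = y" "q ^ (2 * (2 * n)) = y\<^sup>2" "q ^ (n * 4) = y\<^sup>2" "q ^ (2 * n) = y"
      by (auto simp: y_def power_mult[symmetric] mult_ac)
    have "Suc m - 2 * n = 1" "m - 2 * n = 0" "2 * n \<le> Suc m" "\<not> 2 * Suc n \<le> Suc m" using eq by auto
    then show ?thesis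
      using X0 q y0 eq
      by (simp add: wz_summand_def wz_mate_def X_def[symmetric] m qpoch_Suc binomial_eq_0 del: mult_Suc_right)
         (simp add: field_simps power2_eq_square m)
  next
    case gt
    \<comment> \<open>The lengths m - 2n, m + 1 - 2n and m + 1 - 2(n + 1) become s + 1, s + 2 and s,
      so all three q-factorials are multiples of \<open>P\<close>.\<close>
    then obtain s where m: "m = 2 * n + Suc s" by (metis less_imp_Suc_add add_Suc_right)
    define w where "w = q ^ s"
    define P where "P = qpoch q q s"
    define p where "p = q ^ (s choose 2)"
    have P0: "P > 0" using q by (simp add: P_def qpoch_self_pos)
    have p0: "p > 0" using q by (simp add: p_def)
    have w0: "w > 0" using q by (simp add: w_def)
    have P1: "qpoch q q (Suc s) = P * (1 - q * w)" "qpoch q q (Suc (Suc s)) = P * (1 - q * w) * (1 - q\<^sup>2 * w)"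
      by (simp_all add: P_def w_def qpoch_Suc power2_eq_square)
    have wn: "1 - q * w \<noteq> 0" "1 - q\<^sup>2 * w \<noteq> 0"
      using q1[of s] q1[of "Suc s"] by (simp_all add: w_def power2_eq_square)
    have p1: "q ^ (Suc s choose 2) = p * w" "q ^ (Suc (Suc s) choose 2) = p * w\<^sup>2 * q"
      by (simp_all add: p_def w_def numeral_2_eq_2 power_add)
    have qm1: "q ^ m = q * w * y"
      by (simp add: m w_def y_def power_add)
    have qm: "q ^ m = q * w * y" "q ^ (2 * m) = (q * w * y)\<^sup>2" "q ^ (2 * n) = y" "q ^ (2 * Suc n) = q\<^sup>2 * y"
      using qm1 by (simp_all add: power_even_eq y_def power2_eq_square)
    have T: "wz_summand q a (Suc m) n = p * w\<^sup>2 * q / (P * (1 - q * w) * (1 - q\<^sup>2 * w) * X)"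
            "wz_summand q a m n = p * w / (P * (1 - q * w) * X)"
            "wz_summand q a (Suc m) (Suc n) = p / (P * (X * ((1 - q\<^sup>2 * y) * (1 - a * q * y))))"
      by (simp_all add: wz_summand_def m XS X_def[symmetric] P1 p1 flip: P_def p_def del: binomial_Suc_Suc power_Suc mult_Suc_right)
         (simp_all add: XS P_def p_def)
    have "(1 - a * (q * w * y)) * (1 - q * (q * w * y)) * (p * w\<^sup>2 * q / (P * (1 - q * w) * (1 - q\<^sup>2 * w) * X))
           - (1 - a * (q * w * y)\<^sup>2) * (p * w / (P * (1 - q * w) * X))
         = - (q * (q * w * y) / (q\<^sup>2 * y) * (p / (P * X)))
           + q * (q * w * y) / y * (1 - y) * (1 - a * y / q) * (p * w\<^sup>2 * q / (P * (1 - q * w) * (1 - q\<^sup>2 * w) * X))"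
      using P0 p0 w0 wn y0 X0 q
      by (simp add: divide_simps) (simp add: algebra_simps power2_eq_square)
    \<comment> \<open>The multiplier at n + 1 consists, up to a power of q, of exactly the two
      factors that the denominator gains from n to n + 1.\<close>
    moreover have "(1 - q\<^sup>2 * y) * (1 - a * (q\<^sup>2 * y) / q) * (p / (P * (X * ((1 - q\<^sup>2 * y) * (1 - a * q * y))))) = p / (P * X)"
      using nz nz2 q X0 P0 by (simp add: divide_simps power2_eq_square) 
    then have "wz_mate q a m (Suc n) = - (q * (q * w * y) / (q\<^sup>2 * y) * (p / (P * X)))"
      by (simp only: wz_mate_def T qm mult.assoc)
    moreover have "wz_mate q a m n = - (q * (q * w * y) / y * (1 - y) * (1 - a * y / q)
        * (p * w\<^sup>2 * q / (P * (1 - q * w) * (1 - q\<^sup>2 * w) * X)))"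
      by (simp only: wz_mate_def T qm)
    ultimately show ?thesis
      by (simp only: T qm power_Suc minus_mult_left diff_minus_eq_add minus_minus)
  qed
qed

section \<open>Determinants of unit Hessenberg systems\<close>

text \<open>The elimination in the top row is left multiplication by the unit upper triangular
  \<open>L\<close>, which preserves the determinant. The sign is that of the cofactor at position
  (0, n).\<close>

lemma det_unit_hessenberg_system:
  fixes c :: "nat \<Rightarrow> nat \<Rightarrow> 'a :: comm_ring_1"
  assumes sys: "\<And>j. j \<le> n \<Longrightarrow> (\<Sum>i\<le>j. b i * c j i) = p j"
    and diag: "\<And>j. c j j = 1" and zero: "\<And>i j. j < i \<Longrightarrow> c j i = 0"
  shows "det (mat (n + 1) (n + 1) (\<lambda>(i, j). if i = 0 then p j else c j (i - 1))) = (-1) ^ n * b n"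
proof -
  define A where "A = mat (n + 1) (n + 1) (\<lambda>(i, j). if i = 0 then p j else c j (i - 1))"
  define L where "L = mat (n + 1) (n + 1)
    (\<lambda>(i, k). if i = k then 1 else if i = 0 then - b (k - 1) else 0)"
  define M where "M = mat (n + 1) (n + 1)
    (\<lambda>(i, j). if i = 0 then (if j = n then b n else 0) else c j (i - 1))"
  have carr: "A \<in> carrier_mat (n + 1) (n + 1)" "L \<in> carrier_mat (n + 1) (n + 1)"
    "M \<in> carrier_mat (n + 1) (n + 1)"
    by (simp_all add: A_def L_def M_def)
  \<comment> \<open>Only b_0, ..., b_(n-1) have a row to multiply. Equation j < n is exhausted by
    them; equation n leaves over its diagonal term b_n.\<close>
  have row0: "(\<Sum>k<n. b k * c j k) = p j - (if j = n then b n else 0)" if "j \<le> n" for j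
  proof (cases "j = n")
    case True
    then show ?thesis using sys[of n] by (simp add: lessThan_Suc_atMost[symmetric] diag algebra_simps)
  next
    case False
    have "(\<Sum>k<n. b k * c j k) = (\<Sum>k\<le>j. b k * c j k)"
      using that False zero by (intro sum.mono_neutral_right) auto
    then show ?thesis using sys[OF that] False by simp
  qed
  have LA: "L * A = M"
  proof (rule eq_matI)
    fix i j assume ij: "i < dim_row M" "j < dim_col M"
    then have ij': "i < n + 1" "j < n + 1" by (simp_all add: M_def)
    have "(L * A) $$ (i, j) = (\<Sum>k<n + 1. L $$ (i, k) * A $$ (k, j))"
      using ij' carr by (simp add: scalar_prod_def atLeast0LessThan)
    also have "\<dots> = M $$ (i, j)"
    proof (cases "i = 0")
      case True
      have "(\<Sum>k<n + 1. L $$ (i, k) * A $$ (k, j)) = p j - (\<Sum>k<n. b k * c j k)"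
        using True ij' by (simp add: L_def A_def sum.lessThan_Suc_shift sum_negf del: sum.lessThan_Suc)
      then show ?thesis using row0[of j] True ij' by (simp add: M_def)
    next
      case False
      have "(\<Sum>k<n + 1. L $$ (i, k) * A $$ (k, j)) = (\<Sum>k<n + 1. if k = i then A $$ (i, j) else 0)"
        using False ij' by (intro sum.cong) (auto simp: L_def)
      then show ?thesis using False ij' by (simp add: M_def A_def)
    qed
    finally show "(L * A) $$ (i, j) = M $$ (i, j)" .
  qed (simp_all add: A_def L_def M_def)
  have "upper_triangular L"
    by (auto simp: L_def upper_triangular_def)
  then have "det L = 1"
    using det_upper_triangular[OF _ carr(2)] by (simp add: prod_list_diag_prod L_def)
  then have "det A = det M"
    using det_mult[OF carr(2,1)] LA by simp
  also have "\<dots> = (\<Sum>j<n + 1. M $$ (0, j) * cofactor M 0 j)"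
    by (intro laplace_expansion_row carr) simp
  also have "\<dots> = (\<Sum>j<n + 1. if j = n then b n * cofactor M 0 n else 0)"
    by (intro sum.cong) (auto simp: M_def)
  also have "\<dots> = b n * ((-1) ^ n * det (mat_delete M 0 n))"
    by (simp add: cofactor_def)
  \<comment> \<open>Deleting row 0 and column n moves the subdiagonal of ones onto the
    diagonal.\<close>
  also have "mat_delete M 0 n = mat n n (\<lambda>(i, j). c j i)"
    by (rule eq_matI) (simp_all add: mat_delete_def M_def)
  also have "det (mat n n (\<lambda>(i, j). c j i)) = 1"
  proof (subst det_upper_triangular[of _ n])
    show "upper_triangular (mat n n (\<lambda>(i, j). c j i))"
      by (auto simp: upper_triangular_def zero)
  qed (simp_all add: prod_list_diag_prod diag)
  finally show ?thesis by (simp add: A_def mult.commute)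
qed

section \<open>Tools for formal power series\<close>

lemma fps_conv_radius_pos_geometric:
  fixes F :: "'a :: {banach, real_normed_div_algebra} fps"
  assumes "\<And>n. norm (fps_nth F n) \<le> C ^ n"
  shows "fps_conv_radius F > 0"
proof -
  \<comment> \<open>The summand 1 keeps \<open>r\<close> well defined for C = 0; the factor 2 gives
    the ratio 1/2.\<close>
  define r where "r = 1 / (2 * (\<bar>C\<bar> + 1))"
  have r: "r > 0" "\<bar>C\<bar> * r \<le> 1 / 2" by (simp_all add: r_def field_simps)
  have "summable (\<lambda>n. fps_nth F n * of_real r ^ n)"
  proof (rule summable_comparison_test'[of "\<lambda>n. (1 / 2) ^ n" 0])
    show "norm (fps_nth F n * of_real r ^ n) \<le> (1 / 2) ^ n" for n
    proof -
      have "norm (fps_nth F n * of_real r ^ n) \<le> \<bar>C\<bar> ^ n * r ^ n"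
        using assms[of n] r by (simp add: norm_mult norm_power power_abs[symmetric])
      also have "\<dots> = (\<bar>C\<bar> * r) ^ n" by (simp add: power_mult_distrib)
      also have "\<dots> \<le> (1 / 2) ^ n" using r by (intro power_mono) auto
      finally show ?thesis .
    qed
  qed (simp add: summable_geometric)
  then have "fps_conv_radius F \<ge> norm (of_real r :: 'a)"
    unfolding fps_conv_radius_def by (rule conv_radius_geI)
  moreover have "norm (of_real r :: 'a) > 0" using r by simp
  ultimately show ?thesis by (metis less_le_trans ereal_less(2))
qed

text \<open>The substitution multiplies coefficient n by q^n, which differs from 1 for n >
  0.\<close>

lemma fps_compose_scale_fixed_imp_const:
  fixes F :: "real fps"
  assumes "0 < q" "q < 1" and "fps_compose F (fps_const q * fps_X) = F"
  shows "F = fps_const (fps_nth F 0)"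
proof (rule fps_ext)
  fix n
  have "q ^ n * fps_nth F n = fps_nth F n"
    using assms(3) by (metis fps_compose_linear fps_nth_Abs_fps)
  moreover have "q ^ n \<noteq> 1" if "n > 0" using power_less_one_iff[of q n] assms that by fastforce
  ultimately show "fps_nth F n = fps_nth (fps_const (fps_nth F 0)) n" by auto
qed

text \<open>Identities are proved over the reals in x = (1 - q) t / 2; this map, with c = (1 - q) /
  2, carries them to complex series in t.\<close>

definition fps_of_real_scaled :: "real \<Rightarrow> real fps \<Rightarrow> complex fps" where
  "fps_of_real_scaled c F = Abs_fps (\<lambda>n. of_real (fps_nth F n * c ^ n))"

lemma fps_of_real_scaled_mult:
  "fps_of_real_scaled c (F * G) = fps_of_real_scaled c F * fps_of_real_scaled c G"
proof (rule fps_ext)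
  fix n
  have "fps_nth (F * G) n * c ^ n = (\<Sum>i=0..n. (fps_nth F i * c ^ i) * (fps_nth G (n - i) * c ^ (n - i)))"
    unfolding fps_mult_nth sum_distrib_right
  proof (intro sum.cong refl)
    fix i assume "i \<in> {0..n}"
    then have "c ^ n = c ^ i * c ^ (n - i)" by (simp flip: power_add)
    then show "fps_nth F i * fps_nth G (n - i) * c ^ n = (fps_nth F i * c ^ i) * (fps_nth G (n - i) * c ^ (n - i))"
      by simp
  qed
  then show "fps_nth (fps_of_real_scaled c (F * G)) n
      = fps_nth (fps_of_real_scaled c F * fps_of_real_scaled c G) n"
    unfolding fps_of_real_scaled_def fps_nth_Abs_fps by (simp add: fps_mult_nth)
qed

section \<open>The q-Chu-Vandermonde sum in closed form\<close>

lemma wz_sum_Suc: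
  assumes q: "0 < q" "q < 1" and a: "\<And>k. a * q ^ Suc k \<noteq> 1"
  shows "(1 - a * q ^ m) * (1 - q ^ Suc m) * (\<Sum>n\<le>Suc m. wz_summand q a (Suc m) n)
         = (1 - a * q ^ (2 * m)) * (\<Sum>n\<le>m. wz_summand q a m n)"
proof -
  have "(1 - a * q ^ m) * (1 - q ^ Suc m) * (\<Sum>n<Suc (Suc m). wz_summand q a (Suc m) n)
      - (1 - a * q ^ (2 * m)) * (\<Sum>n<Suc (Suc m). wz_summand q a m n)
      = (\<Sum>n<Suc (Suc m). wz_mate q a m (Suc n) - wz_mate q a m n)"
    unfolding wz_equation[OF assms, symmetric] sum_subtractf sum_distrib_left ..
  also have "\<dots> = wz_mate q a m (Suc (Suc m)) - wz_mate q a m 0"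
    by (rule sum_lessThan_telescope)
  \<comment> \<open>The mate vanishes at 0 through its factor 1 - q^0 and at m + 2 through the
    truncation of the summand.\<close>
  also have "\<dots> = 0" by (simp add: wz_mate_def wz_summand_def)
  also have "(\<Sum>n<Suc (Suc m). wz_summand q a m n) = (\<Sum>n\<le>m. wz_summand q a m n)"
    by (simp add: lessThan_Suc_atMost wz_summand_def)
  finally show ?thesis by (simp only: lessThan_Suc_atMost right_minus_eq)
qed

text \<open>Up to a factor independent of n, the sum is a 2phi1 with base and argument q^2, upper
  parameters q^(-m), q^(1-m) and lower parameter aq. The right side is (a; q^2)_m / (a; q)_m with 1
  - a cancelled, over (q; q)_m; at m = 0 the truncated m - 1 leaves empty products.\<close>

lemma wz_sum_closed_form:
  assumes q: "0 < q" "q < 1" and a: "\<And>k. a * q ^ Suc k \<noteq> 1"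
  shows "(\<Sum>n\<le>m. wz_summand q a m n)
         = qpoch (a * q\<^sup>2) (q\<^sup>2) (m - 1) / qpoch (a * q) q (m - 1) / qpoch q q m"
proof (induction m)
  case 0
  then show ?case by (simp add: wz_summand_def binomial_eq_0)
next
  case (Suc m)
  show ?case
  proof (cases m)
    case 0
    \<comment> \<open>From m = 0 to 1 the recurrence has 1 - a on both sides and says nothing if a =
      1, so this value is computed directly.\<close>
    then show ?thesis by (simp add: wz_summand_def binomial_eq_0 qpoch_Suc)
  next
    case (Suc k)
    have n1: "1 - a * q ^ m \<noteq> 0" using a[of k] Suc by simp
    have n2: "1 - q ^ Suc m \<noteq> 0" using power_less_one_iff[of q "Suc m"] q by fastforce
    have "(\<Sum>n\<le>Suc m. wz_summand q a (Suc m) n)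
        = (1 - a * q ^ (2 * m)) * (\<Sum>n\<le>m. wz_summand q a m n) / ((1 - a * q ^ m) * (1 - q ^ Suc m))"
      using wz_sum_Suc[OF assms, where m = m] n1 n2
      by (metis mult_eq_0_iff nonzero_mult_div_cancel_left)
    also have "\<dots> = qpoch (a * q\<^sup>2) (q\<^sup>2) m / qpoch (a * q) q m / qpoch q q (Suc m)"
    proof -
      have "qpoch (a * q\<^sup>2) (q\<^sup>2) m = qpoch (a * q\<^sup>2) (q\<^sup>2) (m - 1) * (1 - a * q ^ (2 * m))"
        using Suc by (simp add: qpoch_Suc power_mult mult.assoc power2_eq_square)
      moreover have "qpoch (a * q) q m = qpoch (a * q) q (m - 1) * (1 - a * q ^ m)"
        using Suc by (simp add: qpoch_Suc mult.assoc)
      moreover have "qpoch q q (Suc m) = qpoch q q m * (1 - q ^ Suc m)"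
        by (simp add: qpoch_Suc)
      ultimately show ?thesis unfolding Suc.IH by (simp add: mult_ac)
    qed
    finally show ?thesis by simp
  qed
qed

text \<open>Both branches agree once 1 - a is cancelled, and a = 1 happens only at \<alpha> = -1/2.
  Later arguments thus avoid the case distinction.\<close>

lemma qpoch_quot_eq:
  fixes q \<alpha> :: real
  assumes q: "0 < q" "q < 1"
  defines "a \<equiv> q powr (2 * \<alpha> + 1)"
  shows "qpoch_quot q \<alpha> m = qpoch (a * q\<^sup>2) (q\<^sup>2) (m - 1) / qpoch (a * q) q (m - 1)"
proof (cases "m = 0")
  case True
  then show ?thesis by (simp add: qpoch_quot_def)
next
  case False
  then obtain k where k: "m = Suc k" by (cases m) auto
  have p: "q powr (2 * \<alpha> + 3) = a * q\<^sup>2" "q powr (2 * \<alpha> + 2) = a * q"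
    using q by (simp_all add: a_def powr_add power2_eq_square power3_eq_cube powr_numeral)
  show ?thesis
  proof (cases "\<alpha> = - 1 / 2")
    case True
    then show ?thesis unfolding qpoch_quot_def p using k by simp
  next
    case False
    then have "a \<noteq> 1" using q by (simp add: a_def powr_eq_one_iff_gen)
    then show ?thesis using False by (simp add: qpoch_quot_def k qpoch_Suc_shift flip: a_def)
  qed
qed

section \<open>The q-series as formal power series\<close>

definition fps_qexp :: "real \<Rightarrow> complex \<Rightarrow> complex fps" where
  "fps_qexp q z = Abs_fps (\<lambda>n. z ^ n / of_real (qfact q n))"

text \<open>Euler's expansion of 1 / (-x; q)_infinity, which is e_q(-t/2) for x = (1 - q) t /
  2.\<close>

definition fps_qexp_small :: "real \<Rightarrow> real fps" where
  "fps_qexp_small q = Abs_fps (\<lambda>n. (-1) ^ n / qpoch q q n)"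

text \<open>Euler's expansion of (-x; q)_infinity.\<close>

definition fps_qexp_big :: "real \<Rightarrow> real fps" where
  "fps_qexp_big q = Abs_fps (\<lambda>n. q ^ (n choose 2) / qpoch q q n)"

text \<open>The series of g(it) in x, with a = q^(2 \<alpha> + 1); the imaginary argument removes
  the alternating signs.\<close>

definition fps_jackson :: "real \<Rightarrow> real \<Rightarrow> real fps" where
  "fps_jackson q a = Abs_fps (\<lambda>n. if even n
     then 1 / (qpoch (q\<^sup>2) (q\<^sup>2) (n div 2) * qpoch (a * q) (q\<^sup>2) (n div 2)) else 0)"

text \<open>Rescaled to t and multiplied by [n]_q!, coefficient n is 2^(-n)
  \<open>qpoch_quot q \<alpha> n\<close>, the matrix entry without its q-binomial.\<close>

definition fps_quot :: "real \<Rightarrow> real \<Rightarrow> real fps" where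
  "fps_quot q \<alpha> = Abs_fps (\<lambda>n. qpoch_quot q \<alpha> n / qpoch q q n)"

text \<open>Both factors satisfy a first-order \<open>q\<close>-difference equation, with reciprocal
  multipliers \<open>1 + X\<close>, so their product is invariant under \<open>X \<mapsto> q X\<close>.\<close>

lemma fps_qexp_small_times_big:
  assumes q: "0 < q" "q < 1"
  shows "fps_qexp_small q * fps_qexp_big q = 1"
proof -
  let ?s = "\<lambda>F. fps_compose F (fps_const q * fps_X)"
  have nz: "qpoch q q n \<noteq> 0" "1 - q * q ^ n \<noteq> 0" for n
    using qpoch_self_pos[OF q, of n] power_less_one_iff[of q "Suc n"] q by fastforce+
  have A: "?s (fps_qexp_small q) = (1 + fps_X) * fps_qexp_small q"
    unfolding fps_compose_linear
  proof (rule fps_ext)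
    fix n show "fps_nth (Abs_fps (\<lambda>n. q ^ n * fps_nth (fps_qexp_small q) n)) n = fps_nth ((1 + fps_X) * fps_qexp_small q) n"
      using nz by (cases n) (simp_all add: fps_qexp_small_def algebra_simps
          qpoch_Suc divide_simps)
  qed
  have E: "(1 + fps_X) * ?s (fps_qexp_big q) = fps_qexp_big q"
    unfolding fps_compose_linear
  proof (rule fps_ext)
    fix n show "fps_nth ((1 + fps_X) * Abs_fps (\<lambda>n. q ^ n * fps_nth (fps_qexp_big q) n)) n = fps_nth (fps_qexp_big q) n"
      using nz by (cases n) (simp_all add: fps_qexp_big_def algebra_simps
          qpoch_Suc divide_simps numeral_2_eq_2 power_add)
  qed
  have "?s (fps_qexp_small q * fps_qexp_big q) = ?s (fps_qexp_small q) * ?s (fps_qexp_big q)"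
    by (rule fps_compose_mult_distrib) simp
  also have "\<dots> = fps_qexp_small q * ((1 + fps_X) * ?s (fps_qexp_big q))"
    unfolding A by (simp only: ac_simps)
  finally have "?s (fps_qexp_small q * fps_qexp_big q) = fps_qexp_small q * fps_qexp_big q"
    by (simp add: E)
  then show ?thesis
    using fps_compose_scale_fixed_imp_const[OF q]
    by (metis (no_types, lifting) binomial_eq_0 div_by_1 fps_const_1_eq_1 fps_mult_nth_0
        fps_nth_Abs_fps fps_qexp_big_def fps_qexp_small_def mult_1 power_0 qpoch_0 zero_less_numeral)
qed

text \<open>Only even indices of the Jackson series contribute to the Cauchy product, whose
  coefficient m is therefore the sum of \<open>wz_summand\<close> over n.\<close>

lemma fps_qexp_big_times_jackson:
  fixes q \<alpha> :: real
  assumes q: "0 < q" "q < 1" and \<alpha>: "\<alpha> > -1"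
  defines "a \<equiv> q powr (2 * \<alpha> + 1)"
  shows "fps_jackson q a * fps_qexp_big q = fps_quot q \<alpha>"
proof (rule fps_ext)
  fix m
  \<comment> \<open>Here \<alpha> > -1 enters: the exponent is at least 2 \<alpha> + 2 > 0. The
    factor q is essential, since a itself is at least 1 for \<alpha> \<le> -1/2.\<close>
  have a: "a * q ^ Suc k \<noteq> 1" for k
  proof -
    have "a * q ^ Suc k = q powr (2 * \<alpha> + 1 + Suc k)"
      using q powr_realpow[of q "Suc k"] by (simp only: a_def powr_add)
    moreover have "\<dots> < 1"
      using powr_less_mono'[of q 0 "2 * \<alpha> + 1 + Suc k"] q \<alpha> by simp
    ultimately show ?thesis by simp
  qed
  have "fps_nth (fps_jackson q a * fps_qexp_big q) m
      = (\<Sum>i\<le>m. fps_nth (fps_jackson q a) i * fps_nth (fps_qexp_big q) (m - i))"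
    by (simp add: fps_mult_nth atMost_atLeast0)
  also have "\<dots> = (\<Sum>i\<in>(\<lambda>n. 2 * n) ` {n. 2 * n \<le> m}.
      fps_nth (fps_jackson q a) i * fps_nth (fps_qexp_big q) (m - i))"
    by (rule sum.mono_neutral_right) (auto simp: fps_jackson_def elim!: evenE)
  also have "\<dots> = (\<Sum>n | 2 * n \<le> m. wz_summand q a m n)"
    by (subst sum.reindex)
       (auto simp: inj_on_def fps_jackson_def fps_qexp_big_def wz_summand_def intro!: sum.cong)
  also have "\<dots> = (\<Sum>n\<le>m. wz_summand q a m n)"
    by (rule sum.mono_neutral_left) (auto simp: wz_summand_def)
  finally show "fps_nth (fps_jackson q a * fps_qexp_big q) m = fps_nth (fps_quot q \<alpha>) m"
    using wz_sum_closed_form[OF q a] qpoch_quot_eq[OF q] by (simp add: fps_quot_def a_def)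
qed


section \<open>Convergence and analytic expansions\<close>

lemma qpoch_ge:
  assumes "0 < b" "b < 1" "0 < p" "p < 1"
  shows "qpoch b p n \<ge> (1 - b) ^ n"
proof -
  have "(\<Prod>k<n. 1 - b) \<le> qpoch b p n"
    unfolding qpoch_def
  proof (rule prod_mono, safe)
    show "1 - b \<le> 1 - b * p ^ k" for k
      using assms mult_left_le[of "p ^ k" b] by (simp add: power_le_one)
  qed (use assms in auto)
  then show ?thesis by simp
qed

lemma qfact_ge_1:
  assumes "0 < q" "q < 1"
  shows "qfact q n \<ge> 1"
  unfolding qfact_def
proof (rule prod_ge_1)
  fix k assume "k \<in> {1..n}"
  then have "q ^ k \<le> q" using assms by (cases k) (simp_all add: mult_left_le power_le_one)
  then show "qnum q k \<ge> 1" using assms by (simp add: qnum_def field_simps)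
qed

lemma has_fps_expansion_qexp:
  assumes "0 < q" "q < 1"
  shows "(\<lambda>t. qexp q (z * t)) has_fps_expansion fps_qexp q z"
proof -
  have "norm (fps_nth (fps_qexp q z) n) \<le> norm z ^ n" for n
    using qfact_ge_1[OF assms, of n]
    by (simp add: fps_qexp_def norm_divide norm_power divide_le_eq mult_left_le_one_le
        mult_le_cancel_left1)
  then have "eval_fps (fps_qexp q z) has_fps_expansion fps_qexp q z"
    by (intro eval_fps_has_fps_expansion fps_conv_radius_pos_geometric)
  also have "eval_fps (fps_qexp q z) = (\<lambda>t. qexp q (z * t))"
    by (simp add: fun_eq_iff eval_fps_def qexp_def fps_qexp_def power_mult_distrib)
  finally show ?thesis .
qed

lemma has_fps_expansion_jackson_g1:
  fixes q \<alpha> :: real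
  assumes q: "0 < q" "q < 1" and \<alpha>: "\<alpha> > -1"
  defines "a \<equiv> q powr (2 * \<alpha> + 1)"
  shows "(\<lambda>t. jackson_g1 q \<alpha> (\<i> * t)) has_fps_expansion
           fps_of_real_scaled ((1 - q) / 2) (fps_jackson q a)"
proof -
  define F where "F = fps_of_real_scaled ((1 - q) / 2) (fps_jackson q a)"
  have aq: "q powr (2 * \<alpha> + 2) = a * q"
    using q by (simp add: a_def powr_add power2_eq_square)
  have b: "0 < a * q" "a * q < 1"
    using powr_less_mono'[of q 0 "2 * \<alpha> + 2"] q \<alpha> by (simp_all flip: aq)
  have q2: "0 < q\<^sup>2" "q\<^sup>2 < 1" using q by (simp_all add: power_less_one_iff)
  \<comment> \<open>By \<open>qpoch_ge\<close>, C^k bounds the product of the two denominators from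
    below. As C \<le> 1, passing from C^k to C^n only weakens the bound.\<close>
  define C where "C = (1 - q\<^sup>2) * (1 - a * q)"
  have C: "0 < C" "C \<le> 1" unfolding C_def using b q2 by (simp_all add: mult_le_one)
  have "norm (fps_nth F n) \<le> (1 / C) ^ n" for n
  proof (cases "even n")
    case True
    define k where "k = n div 2"
    let ?d = "qpoch (q\<^sup>2) (q\<^sup>2) k * qpoch (a * q) (q\<^sup>2) k"
    have d: "?d \<ge> C ^ k"
      unfolding C_def power_mult_distrib using b q2
      by (intro mult_mono qpoch_ge) (auto intro: order.trans[OF _ qpoch_ge])
    have "?d > 0" using d C by (meson less_le_trans zero_less_power)
    then have "((1 - q) / 2) ^ n / ?d \<ge> 0" using q by simp
    moreover have "fps_nth F n = of_real (((1 - q) / 2) ^ n / ?d)"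
      using True by (simp add: F_def fps_of_real_scaled_def fps_jackson_def k_def)
    ultimately have "norm (fps_nth F n) = ((1 - q) / 2) ^ n / ?d"
      by (simp only: norm_of_real abs_of_nonneg)
    also have "\<dots> \<le> 1 / C ^ k"
      using q C d by (intro frac_le) (auto intro: power_le_one)
    also have "\<dots> \<le> 1 / C ^ n"
      using C by (intro divide_left_mono power_decreasing) (auto simp: k_def)
    finally show ?thesis by (simp add: power_one_over)
  next
    case False
    then show ?thesis using C by (simp add: F_def fps_of_real_scaled_def fps_jackson_def)
  qed
  then have "eval_fps F has_fps_expansion F"
    by (intro eval_fps_has_fps_expansion fps_conv_radius_pos_geometric)
  also have "eval_fps F = (\<lambda>t. jackson_g1 q \<alpha> (\<i> * t))"
  proof
    fix t
    have "(-1) * (\<i> * t * of_real (1 - q) / 2)\<^sup>2 = (of_real ((1 - q) / 2))\<^sup>2 * t\<^sup>2"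
      by (simp add: power_mult_distrib power_divide)
    then have "(-1) ^ n * (\<i> * t * of_real (1 - q) / 2) ^ (2 * n)
        = of_real (((1 - q) / 2) ^ (2 * n)) * t ^ (2 * n)" for n
      unfolding power_mult of_real_power by (metis power_mult_distrib)
    then have "jackson_g1 q \<alpha> (\<i> * t) = (\<Sum>n. fps_nth F (2 * n) * t ^ (2 * n))"
      by (simp add: jackson_g1_def F_def fps_of_real_scaled_def fps_jackson_def aq)
    also have "\<dots> = (\<Sum>n. fps_nth F n * t ^ n)"
      by (rule suminf_mono_reindex[of "\<lambda>n. 2 * n"])
         (auto simp: strict_mono_def F_def fps_of_real_scaled_def fps_jackson_def elim!: evenE)
    finally show "eval_fps F t = jackson_g1 q \<alpha> (\<i> * t)"
      by (simp add: eval_fps_def)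
  qed
  finally show ?thesis by (simp add: F_def)
qed

lemma fps_of_real_scaled_qexp_small:
  assumes "0 < q" "q < 1"
  shows "fps_of_real_scaled ((1 - q) / 2) (fps_qexp_small q) = fps_qexp q (- 1 / 2)"
  using assms
  by (intro fps_ext) (simp add: fps_of_real_scaled_def fps_qexp_small_def fps_qexp_def
      qfact_eq_qpoch power_divide power_minus[of "1 / 2"] divide_simps)

section \<open>From the generating function to the linear system\<close>

text \<open>This resolves the definite description: convergence of \<open>F\<close> near 0 gives
  existence, uniqueness of power series expansions gives the rest.\<close>

lemma qBernoulli1_eqI:
  assumes "0 < q" "q < 1"
    and F: "(\<lambda>t. qexp q (z * t) * qexp q (- t / 2) / jackson_g1 q \<alpha> (\<i> * t)) has_fps_expansion F"
  shows "qBernoulli1 q \<alpha> n z = fps_nth F n * of_real (qfact q n)"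
proof -
  let ?Q = "\<lambda>t. qexp q (z * t) * qexp q (- t / 2) / jackson_g1 q \<alpha> (\<i> * t)"
  let ?P = "\<lambda>b. \<forall>\<^sub>F t in nhds 0. (\<lambda>m. b m * (t ^ m / of_real (qfact q m))) sums ?Q t"
  have nz: "complex_of_real (qfact q m) \<noteq> 0" for m
    using qfact_ge_1[OF assms(1,2), of m] by auto
  have "(THE b. ?P b) = (\<lambda>m. fps_nth F m * of_real (qfact q m))"
  proof (rule the_equality)
    from F have r: "fps_conv_radius F > 0" and ev: "\<forall>\<^sub>F t in nhds 0. eval_fps F t = ?Q t"
      by (simp_all add: has_fps_expansion_def)
    have "\<forall>\<^sub>F t in nhds 0. t \<in> eball 0 (fps_conv_radius F)"
      using r by (intro eventually_nhds_in_open) (auto simp: zero_ereal_def)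
    with ev show "?P (\<lambda>m. fps_nth F m * of_real (qfact q m))"
    proof eventually_elim
      case (elim t)
      then have "summable (\<lambda>m. fps_nth F m * t ^ m)"
        by (intro summable_fps) auto
      with elim(1) show ?case using nz by (simp add: sums_iff eval_fps_def)
    qed
  next
    fix b assume b: "?P b"
    have "?Q has_fps_expansion Abs_fps (\<lambda>m. b m / of_real (qfact q m))"
      by (rule has_fps_expansionI) (use b in \<open>simp add: mult.commute\<close>)
    from fps_expansion_unique_complex[OF F this]
    show "b = (\<lambda>m. fps_nth F m * of_real (qfact q m))"
      using nz by (simp add: fun_eq_iff)
  qed
  then show ?thesis by (simp add: qBernoulli1_def)
qed

lemma qBernoulli1_linear_system:
  fixes q \<alpha> :: real and z :: complex
  assumes q: "0 < q" "q < 1" and \<alpha>: "\<alpha> > -1"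
  shows "(\<Sum>i\<le>j. qBernoulli1 q \<alpha> i z
           * of_real (qbinom q j i * (1 / 2 ^ (j - i)) * qpoch_quot q \<alpha> (j - i))) = z ^ j"
proof -
  define h where "h = (1 - q) / 2"
  define G where "G = fps_of_real_scaled h (fps_jackson q (q powr (2 * \<alpha> + 1)))"
  define D where "D = fps_of_real_scaled h (fps_quot q \<alpha>)"
  define A where "A = fps_qexp q (- 1 / 2)"
  define B where "B = fps_qexp q z * A / G"
  have qf: "qfact q m > 0" for m
    using qfact_ge_1[OF q, of m] by simp
  have G0: "fps_nth G 0 \<noteq> 0"
    by (simp add: G_def fps_of_real_scaled_def fps_jackson_def)
  have A0: "A \<noteq> 0"
  proof
    assume "A = 0"
    then have "fps_nth A 0 = 0" by simp
    then show False by (simp add: A_def fps_qexp_def qfact_def)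
  qed
  \<comment> \<open>Multiply the product formula by the reciprocal of
    \<open>fps_qexp_big q\<close>.\<close>
  have "fps_jackson q (q powr (2 * \<alpha> + 1)) = fps_quot q \<alpha> * fps_qexp_small q"
    using fps_qexp_small_times_big[OF q] fps_qexp_big_times_jackson[OF q \<alpha>]
    by (metis mult.assoc mult.commute mult_1)
  then have GDA: "G = D * A"
    by (simp add: G_def D_def A_def h_def fps_of_real_scaled_mult fps_of_real_scaled_qexp_small q)
  have "B * G = fps_qexp q z * A"
    using G0 unfolding B_def by (simp add: fps_divide_unit mult.assoc inverse_mult_eq_1)
  \<comment> \<open>Formal power series over a field form an integral domain, so the common factor
    e_q(-t/2) cancels.\<close>
  then have BD: "B * D = fps_qexp q z"
    using A0 by (simp add: GDA flip: mult.assoc)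
  have "(\<lambda>t. qexp q (- 1 / 2 * t)) has_fps_expansion A"
    unfolding A_def by (rule has_fps_expansion_qexp[OF q])
  then have "(\<lambda>t. qexp q (z * t) * qexp q (- t / 2) / jackson_g1 q \<alpha> (\<i> * t)) has_fps_expansion B"
    unfolding B_def G_def h_def using q \<alpha> G0
    by (intro has_fps_expansion_divide' has_fps_expansion_mult has_fps_expansion_qexp
        has_fps_expansion_jackson_g1) (simp_all add: G_def h_def)
  note b = qBernoulli1_eqI[OF q this]
  have "z ^ j = of_real (qfact q j) * fps_nth (B * D) j"
    using qf[of j] by (simp add: BD fps_qexp_def)
  also have "\<dots> = (\<Sum>i\<le>j. of_real (qfact q j) * (fps_nth B i * fps_nth D (j - i)))"
    by (simp add: fps_mult_nth sum_distrib_left atMost_atLeast0)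
  also have "\<dots> = (\<Sum>i\<le>j. qBernoulli1 q \<alpha> i z
           * of_real (qbinom q j i * (1 / 2 ^ (j - i)) * qpoch_quot q \<alpha> (j - i)))"
  proof (rule sum.cong)
    fix i assume "i \<in> {..j}"
    then obtain k where k: "j = i + k" using le_Suc_ex by auto
    have P: "qpoch q q m > 0" for m by (rule qpoch_self_pos[OF q])
    \<comment> \<open>Since [j]_q! = (q; q)_j / (1 - q)^j, the power (1 - q)^k inside h^k turns (1 -
      q)^(-j) into (1 - q)^(-i); what remains of h^k is 2^(-k).\<close>
    have "qfact q j * (qpoch_quot q \<alpha> k / qpoch q q k * h ^ k)
        = qfact q i * (qbinom q j i * (1 / 2 ^ k) * qpoch_quot q \<alpha> k)"
      using P[of i] P[of j] P[of k] q
      by (simp add: k qfact_eq_qpoch qbinom_def h_def power_divide power_add divide_simps)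
    then have "complex_of_real (qfact q j) * of_real (qpoch_quot q \<alpha> k / qpoch q q k * h ^ k)
        = of_real (qfact q i) * of_real (qbinom q j i * (1 / 2 ^ k) * qpoch_quot q \<alpha> k)"
      by (metis of_real_mult)
    then show "of_real (qfact q j) * (fps_nth B i * fps_nth D (j - i)) = qBernoulli1 q \<alpha> i z
           * of_real (qbinom q j i * (1 / 2 ^ (j - i)) * qpoch_quot q \<alpha> (j - i))"
      by (simp only: b D_def fps_of_real_scaled_def fps_quot_def fps_nth_Abs_fps k add_diff_cancel_left'
          mult.assoc mult.left_commute[of _ "fps_nth B i"])
  qed simp
  finally show ?thesis ..
qed

theorem theorem2p2:
  fixes q \<alpha> :: real and n :: nat and z :: complex
  assumes "0 < q" and "q < 1" and "\<alpha> > -1"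
  shows "qBernoulli1 q \<alpha> n z = (-1) ^ n * det (qBernoulli1_mat q \<alpha> n z)"
proof -
  define c :: "nat \<Rightarrow> nat \<Rightarrow> complex" where
    "c = (\<lambda>j i. of_real (qbinom q j i * (1 / 2 ^ (j - i)) * qpoch_quot q \<alpha> (j - i)))"
  \<comment> \<open>For i >= 1 the truncated differences j + 1 - i and j - (i - 1) coincide.\<close>
  have "qBernoulli1_mat q \<alpha> n z
      = mat (n + 1) (n + 1) (\<lambda>(i, j). if i = 0 then z ^ j else c j (i - 1))"
    unfolding qBernoulli1_mat_def
    by (rule eq_matI) (auto simp: c_def)
  also have "det \<dots> = (-1) ^ n * qBernoulli1 q \<alpha> n z"
  proof (rule det_unit_hessenberg_system)
    show "(\<Sum>i\<le>j. qBernoulli1 q \<alpha> i z * c j i) = z ^ j" for j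
      unfolding c_def using assms by (rule qBernoulli1_linear_system)
    \<comment> \<open>Index m = 0 falls under the general branch of \<open>qpoch_quot\<close> even
      at \<alpha> = -1/2, and empty products give 1.\<close>
    show "c j j = 1" for j
      using qpoch_self_pos[of q j] assms by (simp add: c_def qbinom_def qpoch_quot_def)
    show "c j i = 0" if "j < i" for i j
      using that by (simp add: c_def qbinom_def)
  qed
  finally show ?thesis by (simp flip: mult.assoc power_add)
qed

end
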